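(* For each $r\in\mathbb{Q}^+$ there exists an infinite pairwise disjoint subfamily $\mathcal{H}_r\subseteq\mathcal{E}_r$. That is, there is an infinite family $\mathcal{H}_r$ of pairwise disjoint finite nonempty subsets of $\mathbb{N}$ such that $\sigma S=r$ for every $S\in\mathcal{H}_r$.
   Context: $\mathbb{N}=\{1,2,3,\ldots\}$ and $\mathbb{Q}^+$ is the set of positive rational numbers. $\mathcal{E}$ is the family of all finite nonempty subsets of $\mathbb{N}$. For $S\in\mathcal{E}$, $\sigma S:=\sum_{x\in S}\frac1x$. For $r\in\mathbb{Q}^+$, $\mathcal{E}_r:=\{S\in\mathcal{E}:\sigma S=r\}$. A family of sets is pairwise disjoint if any two distinct members have empty intersection. *)

theory Defs
  imports Complex_Main "HOL-Library.Disjoint_Sets"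
begin

text \<open>
  The positive integers are the nonzero elements of \<^typ>\<open>nat\<close>, so membership of \<open>0\<close> has to be
  excluded explicitly.
\<close>

definition finite_nonempty_pos_sets :: "nat set set" where
  "finite_nonempty_pos_sets = {S. finite S \<and> S \<noteq> {} \<and> 0 \<notin> S}"

definition recip_sum :: "nat set \<Rightarrow> rat" where
  "recip_sum S = (\<Sum>x\<in>S. 1 / of_nat x)"

definition sets_with_recip_sum :: "rat \<Rightarrow> nat set set" where
  "sets_with_recip_sum r = {S \<in> finite_nonempty_pos_sets. recip_sum S = r}"

end

theory Submission
  imports Defs "HOL-Analysis.Harmonic_Numbers"
begin

text \<open>
  Every positive rational \<open>r\<close> is a sum of distinct unit fractions whose denominators all exceed
  a prescribed bound \<open>N\<close> (\<open>sets_with_recip_sum_beyond\<close>). Granting this, new representations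
  of \<open>r\<close> can be chosen one after the other, each living beyond the maximum of the previous one, and
  they are pairwise disjoint (\<open>infinite_disjoint_subfamily\<close>).

  For the representation beyond \<open>N\<close>, subtract the consecutive fractions
  \<open>1/(N+1), 1/(N+2), \<dots>, 1/M\<close> from \<open>r\<close> for as long as the remainder stays nonnegative. The
  divergence of the harmonic series makes this stop, with a remainder less than \<open>1/(M+1)\<close>.
  The greedy algorithm of Fibonacci and Sylvester writes this remainder as a sum of distinct unit
  fractions (\<open>greedy_unit_fractions\<close>); because the remainder is small, they all have
  denominators greater than \<open>M + 1\<close>, and so they do not collide with the fractions already used.
\<close>

text \<open>
  The greedy step subtracts from \<open>a/b\<close> the largest unit fraction \<open>1/n \<le> a/b\<close>. The new numerator
  \<open>a n - b\<close> is smaller than \<open>a\<close> since \<open>a (n - 1) < b\<close>, so the process ends. The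
  remainder is less than \<open>1/n\<close>, so the bound \<open>m\<close> can be replaced by \<open>n\<close> in the next step;
  carrying it through the induction is what makes the denominators distinct.
\<close>

lemma greedy_unit_fractions:
  fixes a b m :: nat
  assumes "m \<ge> 1" and "a * m < b"
  shows "\<exists>S. finite S \<and> S \<subseteq> {m<..} \<and> recip_sum S = of_nat a / of_nat b"
  using assms
proof (induction a arbitrary: b m rule: less_induct)
  case (less a)
  show ?case
  proof (cases "a = 0")
    case True
    then show ?thesis by (intro exI[of _ "{}"]) (simp add: recip_sum_def)
  next
    case False
    define n where "n = (LEAST n. b \<le> a * n)"
    have "b \<le> a * b" using False by simp
    then have n: "b \<le> a * n" unfolding n_def by (rule LeastI)
    have "m < n"
      using less.prems(2) n by (meson leI le_trans mult_le_mono2 not_le)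
    then have "n > 0" by simp
    have "a * (n - 1) < b"
      using not_less_Least[of "n - 1" "\<lambda>n. b \<le> a * n"] \<open>n > 0\<close> unfolding n_def by auto
    then have an: "a * n < a + b"
      using \<open>n > 0\<close> by (cases n) auto
    have "a \<le> a * m" using less.prems(1) by simp
    then have "a < b" using less.prems(2) by linarith
    have smaller: "a * n - b < a" using an n by linarith
    have "a * n - b < b" using an \<open>a < b\<close> by linarith
    then have small_remainder: "(a * n - b) * n < b * n" using \<open>n > 0\<close> by simp
    obtain S where S: "finite S" "S \<subseteq> {n<..}"
      "recip_sum S = of_nat (a * n - b) / of_nat (b * n)"
      using less.IH[OF smaller _ small_remainder] \<open>n > 0\<close> by auto
    have "recip_sum (insert n S) = 1 / of_nat n + recip_sum S"
      unfolding recip_sum_def using S(1,2) by (subst sum.insert) auto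
    also have "\<dots> = of_nat a / of_nat b"
      using n \<open>n > 0\<close> \<open>a < b\<close> by (simp add: S(3) of_nat_diff field_simps)
    finally show ?thesis
      using S(1,2) \<open>m < n\<close> by (intro exI[of _ "insert n S"]) auto
  qed
qed

lemma of_rat_recip_sum_atLeastAtMost: "of_rat (recip_sum {1..n}) = (harm n :: real)"
  by (simp add: recip_sum_def harm_def of_rat_sum of_rat_divide inverse_eq_divide)

lemma recip_sum_unbounded_beyond:
  fixes c :: rat
  shows "\<exists>M. recip_sum {N<..M} > c"
proof -
  have "eventually (\<lambda>M. (harm M :: real) > of_rat (c + recip_sum {1..N})) sequentially"
    using harm_at_top by (simp add: filterlim_at_top_dense)
  then have "eventually (\<lambda>M. M \<ge> N \<and> (harm M :: real) > of_rat (c + recip_sum {1..N})) sequentially"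
    using eventually_ge_at_top[of N] by eventually_elim simp
  then obtain M where M: "M \<ge> N" "(harm M :: real) > of_rat (c + recip_sum {1..N})"
    by (auto dest: eventually_happens)
  have "c + recip_sum {1..N} < recip_sum {1..M}"
    using M(2) by (simp only: of_rat_recip_sum_atLeastAtMost[symmetric] of_rat_less)
  also have "{1..M} = {1..N} \<union> {N<..M}" using M(1) by auto
  also have "recip_sum \<dots> = recip_sum {1..N} + recip_sum {N<..M}"
    unfolding recip_sum_def by (rule sum.union_disjoint) auto
  finally show ?thesis by auto
qed

lemma sets_with_recip_sum_beyond:
  fixes r :: rat
  assumes "r > 0"
  shows "\<exists>S \<in> sets_with_recip_sum r. S \<subseteq> {N<..}"
proof -
  \<comment> \<open>\<open>K\<close> is the first place at which the partial sums beyond \<open>N\<close> exceed \<open>r\<close>; in the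
      informal description it is \<open>M + 1\<close>.\<close>
  define K where "K = (LEAST K. recip_sum {N<..K} > r)"
  have K: "recip_sum {N<..K} > r"
    unfolding K_def using recip_sum_unbounded_beyond by (rule LeastI_ex)
  have "K > N"
  proof (rule ccontr)
    assume "\<not> K > N"
    then show False using K assms by (simp add: recip_sum_def)
  qed
  then have "K \<ge> 1" by simp
  define d where "d = r - recip_sum {N<..<K}"
  have "{N<..K - 1} = {N<..<K}" using \<open>K \<ge> 1\<close> by auto
  then have "recip_sum {N<..<K} \<le> r"
    using not_less_Least[of "K - 1" "\<lambda>K. recip_sum {N<..K} > r"] \<open>K \<ge> 1\<close>
    unfolding K_def[symmetric] by (simp add: not_less)
  then have "d \<ge> 0" by (simp add: d_def)
  have "{N<..K} = insert K {N<..<K}" using \<open>K > N\<close> by auto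
  then have "recip_sum {N<..K} = 1 / of_nat K + recip_sum {N<..<K}"
    by (simp add: recip_sum_def)
  then have "d < 1 / of_nat K" using K by (simp add: d_def)
  obtain p q :: int where pq: "d = of_int p / of_int q" "q > 0"
    by (metis quotient_of_div quotient_of_denom_pos surj_pair)
  have "p \<ge> 0" using \<open>d \<ge> 0\<close> pq by (simp add: zero_le_divide_iff)
  define a b where "a = nat p" and "b = nat q"
  have d: "d = of_nat a / of_nat b" and "b > 0"
    using pq \<open>p \<ge> 0\<close> by (simp_all add: a_def b_def)
  have "(of_nat (a * K) :: rat) < of_nat b"
    using \<open>d < 1 / of_nat K\<close> \<open>b > 0\<close> \<open>K \<ge> 1\<close> by (simp add: d field_simps)
  then have "a * K < b" by (simp only: of_nat_less_iff)
  then obtain T where T: "finite T" "T \<subseteq> {K<..}" "recip_sum T = d"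
    using greedy_unit_fractions[OF \<open>K \<ge> 1\<close>] d by metis
  define S where "S = {N<..<K} \<union> T"
  have "recip_sum S = recip_sum {N<..<K} + recip_sum T"
    unfolding recip_sum_def S_def using T(1,2) by (intro sum.union_disjoint) auto
  then have sum_S: "recip_sum S = r" by (simp add: T(3) d_def)
  then have "S \<noteq> {}" using assms by (auto simp: recip_sum_def)
  moreover have "finite S" "S \<subseteq> {N<..}" using T(1,2) \<open>K > N\<close> by (auto simp: S_def)
  ultimately show ?thesis
    using sum_S by (auto simp: sets_with_recip_sum_def finite_nonempty_pos_sets_def)
qed

lemma infinite_disjoint_subfamily:
  fixes A :: "nat set set"
  assumes beyond: "\<And>N. \<exists>S \<in> A. S \<subseteq> {N<..}"
    and fin: "\<And>S. S \<in> A \<Longrightarrow> finite S \<and> S \<noteq> {}"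
  shows "\<exists>H. H \<subseteq> A \<and> infinite H \<and> disjoint H"
proof -
  obtain F where F: "\<And>N. F N \<in> A" "\<And>N. F N \<subseteq> {N<..}"
    using beyond by metis
  \<comment> \<open>The bounds \<open>u k\<close> cut the positive integers into blocks, and the \<open>k\<close>-th set lies in
      the \<open>k\<close>-th block.\<close>
  define u where "u k = ((\<lambda>N. Max (F N)) ^^ k) 0" for k
  have u_Suc: "u (Suc k) = Max (F (u k))" for k by (simp add: u_def)
  have block: "F (u k) \<subseteq> {u k<..u (Suc k)}" for k
    using F[of "u k"] fin by (auto simp: u_Suc)
  have nonempty: "F (u k) \<noteq> {}" for k using F(1) fin by blast
  have "u k \<le> u (Suc k)" for k
    using block[of k] nonempty[of k] by fastforce
  then have mono: "u i \<le> u j" if "i \<le> j" for i j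
    using that by (rule lift_Suc_mono_le)
  have disj_less: "F (u i) \<inter> F (u j) = {}" if "i < j" for i j
    using block[of i] block[of j] mono[of "Suc i" j] that by fastforce
  have disj: "F (u i) \<inter> F (u j) = {}" if "i \<noteq> j" for i j
    using that disj_less[of i j] disj_less[of j i] by (cases "i < j") auto
  have "inj (\<lambda>k. F (u k))"
    using disj nonempty by (intro injI) (metis Int_absorb)
  then have "infinite (range (\<lambda>k. F (u k)))" by (rule range_inj_infinite)
  moreover have "disjoint (range (\<lambda>k. F (u k)))"
    using disj by (intro disjoint_family_on_disjoint_image) (simp add: disjoint_family_on_def)
  moreover have "range (\<lambda>k. F (u k)) \<subseteq> A" using F(1) by auto
  ultimately show ?thesis by blast
qed

theorem theorem1p1:
  fixes r :: rat
  assumes "r > 0"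
  shows "\<exists>H. H \<subseteq> sets_with_recip_sum r \<and> infinite H \<and> disjoint H"
proof (rule infinite_disjoint_subfamily)
  show "\<exists>S \<in> sets_with_recip_sum r. S \<subseteq> {N<..}" for N
    using assms by (rule sets_with_recip_sum_beyond)
  show "finite S \<and> S \<noteq> {}" if "S \<in> sets_with_recip_sum r" for S
    using that by (simp add: sets_with_recip_sum_def finite_nonempty_pos_sets_def)
qed

end
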